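(* Let $X$ be a self-decomposable real random variable that has moments of every order and has background driving Lévy process $Z$. Then $$C_{Z(s)}(u)=s\,K_{-1}^H[\mu_X](iu),\qquad s\ge0.$$
   Context: Coefficients are real and $\mathbb{N}=\{0,1,2,\dots\}$. The Hurwitz moment series of $X$ is the map $\mu_X:\mathbb{N}\to\mathbb{R}$, $\mu_X(n)=\mathbb{E}[X^n]$. For a map $f:\mathbb{N}\to\mathbb{R}$ with $f(0)=1$, $$K_{-1}^H[f](z)=z\frac{d}{dz}\log\left(1+\sum_{n\ge1}\frac{f(n)}{n!}z^n\right),$$ where the logarithm is the coefficientwise logarithm of a series with constant term one. This is the case $t=-1$ of the $t$-deformed Hurwitz cumulant transform $K_t^H[f](z)=-\frac{z}{t}\frac{d}{dz}\log\bigl(1+\sum_{n\ge1}\frac{t^n}{t(t-1)\cdots(t-n+1)}f(n)z^n\bigr)$. For a random variable $Y$, $C_Y(u)=\log\mathbb{E}[e^{iuY}]$ denotes its characteristic exponent. A random variable $X$ is self-decomposable if, for each $c\in(0,1)$, one can write $X\stackrel{d}{=}cX+X_c$ with $X_c$ independent of $X$. Such a law has a background driving Lévy process $Z=\{Z(s)\}_{s\ge0}$ satisfying the random integral representation $X\stackrel{d}{=}\int_0^\infty e^{-s}\,dZ(s)$, and its characteristic exponent obeys $C_{Z(s)}(u)=su\frac{d}{du}C_X(u)$. *)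

theory Defs
  imports "HOL-Probability.Probability" "HOL-Analysis.FPS_Convergence"
begin

section \<open>Moments and the Hurwitz cumulant transform\<close>

definition all_moments :: "'a measure \<Rightarrow> ('a \<Rightarrow> real) \<Rightarrow> bool" where
  "all_moments M X \<longleftrightarrow> (\<forall>n::nat. integrable M (\<lambda>\<omega>. X \<omega> ^ n))"

definition hurwitz_moments :: "'a measure \<Rightarrow> ('a \<Rightarrow> real) \<Rightarrow> nat \<Rightarrow> real" where
  "hurwitz_moments M X n = (\<integral>\<omega>. X \<omega> ^ n \<partial>M)"

text \<open>
  The transform is a formal power series; nothing is assumed about convergence.
  \<^term>\<open>fps_ln 1\<close> is the series of \<open>log (1 + z)\<close>, so the composition below is the
  coefficientwise logarithm of \<open>1 + (\<Sum>n\<ge>1. f n / n! z ^ n)\<close>. The value \<open>f 0\<close>, which is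
  \<open>1\<close> for the intended arguments, does not enter.
\<close>

definition hurwitz_cumulant :: "(nat \<Rightarrow> real) \<Rightarrow> real fps" where
  "hurwitz_cumulant f =
     fps_X * fps_deriv (fps_ln 1 oo Abs_fps (\<lambda>n. if n = 0 then 0 else f n / fact n))"

text \<open>The series \<open>F(iu)\<close>, as a formal power series in \<open>u\<close> with complex coefficients.\<close>

definition fps_at_iu :: "real fps \<Rightarrow> complex fps" where
  "fps_at_iu F = Abs_fps (\<lambda>n. complex_of_real (fps_nth F n) * \<i> ^ n)"

text \<open>\<open>f\<close> is infinitely differentiable and its Taylor series at the origin is \<open>F\<close>.\<close>

definition has_taylor_fps :: "(real \<Rightarrow> complex) \<Rightarrow> complex fps \<Rightarrow> bool" where
  "has_taylor_fps f F \<longleftrightarrow>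
     (\<exists>D :: nat \<Rightarrow> real \<Rightarrow> complex.
        D 0 = f \<and>
        (\<forall>n x. (D n has_vector_derivative D (Suc n) x) (at x)) \<and>
        (\<forall>n. fps_nth F n = D n 0 / fact n))"


section \<open>Characteristic exponents and self-decomposability\<close>

text \<open>
  The logarithm of a characteristic function is the distinguished one: the unique continuous
  branch along the real line that vanishes at \<open>0\<close>. It exists when the characteristic function
  has no zeros. The principal branch \<^term>\<open>Ln\<close> would in general introduce jumps.
\<close>

definition char_exponent :: "real measure \<Rightarrow> real \<Rightarrow> complex" where
  "char_exponent \<mu> =
     (THE C. continuous_on UNIV C \<and> C 0 = 0 \<and> (\<forall>u. exp (C u) = char \<mu> u))"

text \<open>
  Self-decomposability is a property of the law of \<open>X\<close>: the space \<open>M\<close> itself need not carry a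
  variable independent of \<open>X\<close>, so the decomposition is realised by an independent pair
  \<open>(X', Xc)\<close>, with \<open>X'\<close> a copy of \<open>X\<close>, on some probability space. Taking the sample space to be
  the plane loses no generality, as only the joint law of the pair matters.
\<close>

definition self_decomposable :: "'a measure \<Rightarrow> ('a \<Rightarrow> real) \<Rightarrow> bool" where
  "self_decomposable M X \<longleftrightarrow>
     (\<forall>c\<in>{0<..<1}. \<exists>(P :: (real \<times> real) measure) X' Xc.
        prob_space P \<and>
        prob_space.indep_var P borel X' borel Xc \<and>
        distr P borel X' = distr M borel X \<and>
        distr M borel X = distr P borel (\<lambda>\<omega>. c * X' \<omega> + Xc \<omega>))"


section \<open>Levy processes and the random integral representation\<close>

definition cadlag :: "(real \<Rightarrow> real) \<Rightarrow> bool" where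
  "cadlag y \<longleftrightarrow>
     (\<forall>t\<ge>0. continuous (at_right t) y) \<and> (\<forall>t>0. \<exists>l. (y \<longlongrightarrow> l) (at_left t))"

text \<open>Only the times \<open>t \<ge> 0\<close> are relevant.\<close>

definition levy_process :: "'b measure \<Rightarrow> (real \<Rightarrow> 'b \<Rightarrow> real) \<Rightarrow> bool" where
  "levy_process N Z \<longleftrightarrow>
     prob_space N \<and>
     (\<forall>t\<ge>0. Z t \<in> borel_measurable N) \<and>
     (AE \<omega> in N. Z 0 \<omega> = 0) \<and>
     (\<forall>n (t :: nat \<Rightarrow> real). 0 \<le> t 0 \<and> (\<forall>k<n. t k < t (Suc k)) \<longrightarrow>
        prob_space.indep_vars N (\<lambda>_. borel) (\<lambda>k \<omega>. Z (t (Suc k)) \<omega> - Z (t k) \<omega>) {..<n}) \<and>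
     (\<forall>r\<ge>0. \<forall>t\<ge>0. distr N borel (\<lambda>\<omega>. Z (r + t) \<omega> - Z r \<omega>)
                    = distr N borel (\<lambda>\<omega>. Z t \<omega> - Z 0 \<omega>)) \<and>
     (\<forall>t\<ge>0. \<forall>e>0.
        ((\<lambda>r. measure N {\<omega> \<in> space N. \<bar>Z r \<omega> - Z t \<omega>\<bar> > e}) \<longlongrightarrow> 0) (at t within {0..})) \<and>
     (AE \<omega> in N. cadlag (\<lambda>t. Z t \<omega>))"

text \<open>
  Riemann--Stieltjes integral of \<open>f\<close> against \<open>g\<close> over \<open>[a, b]\<close>, as the limit of tagged sums when
  the mesh tends to zero. For \<open>f\<close> continuous and monotone and \<open>g\<close> cadlag it exists, and it agrees
  with the definition of the pathwise integral by formal integration by parts.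
\<close>

definition has_RS_integral ::
    "(real \<Rightarrow> real) \<Rightarrow> (real \<Rightarrow> real) \<Rightarrow> real \<Rightarrow> real \<Rightarrow> real \<Rightarrow> bool" where
  "has_RS_integral f g a b I \<longleftrightarrow>
     (\<forall>e>0. \<exists>d>0. \<forall>n (t :: nat \<Rightarrow> real) \<xi>.
        t 0 = a \<and> t n = b \<and>
        (\<forall>k<n. t k \<le> \<xi> k \<and> \<xi> k \<le> t (Suc k) \<and> t (Suc k) - t k < d) \<longrightarrow>
        \<bar>(\<Sum>k<n. f (\<xi> k) * (g (t (Suc k)) - g (t k))) - I\<bar> < e)"

definition has_RS_integral_0_infinity ::
    "(real \<Rightarrow> real) \<Rightarrow> (real \<Rightarrow> real) \<Rightarrow> real \<Rightarrow> bool" where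
  "has_RS_integral_0_infinity f g I \<longleftrightarrow>
     (\<exists>J. (\<forall>T\<ge>0. has_RS_integral f g 0 T (J T)) \<and> (J \<longlongrightarrow> I) at_top)"

text \<open>
  \<open>Z\<close> is a Levy process with \<open>X = \<integral>\<^sub>0\<^sup>\<infinity> exp (-s) dZ(s)\<close> in distribution, the integral being taken
  pathwise, almost surely. \<open>X\<close> and \<open>Z\<close> may live on different probability spaces.
\<close>

definition background_driving_levy_process ::
    "'a measure \<Rightarrow> ('a \<Rightarrow> real) \<Rightarrow> 'b measure \<Rightarrow> (real \<Rightarrow> 'b \<Rightarrow> real) \<Rightarrow> bool" where
  "background_driving_levy_process M X N Z \<longleftrightarrow>
     levy_process N Z \<and>
     (\<exists>I \<in> borel_measurable N.
        (AE \<omega> in N. has_RS_integral_0_infinity (\<lambda>s. exp (- s)) (\<lambda>s. Z s \<omega>) (I \<omega>)) \<and>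
        distr M borel X = distr N borel I)"

end

theory Submission imports Defs begin

text \<open>
  Let \<open>\<psi>\<close> be the exponent of the Levy process, \<open>E exp (iu Z(t)) = exp (t \<psi>(u))\<close>. Riemann--Stieltjes
  sums of independent increments give \<open>E exp (iu \<integral>\<^sub>0\<^sup>T exp (-x) dZ(x)) = exp (\<integral>\<^sub>0\<^sup>T \<psi>(u exp (-x)) dx)\<close>.
  Letting the upper limit tend to infinity and splitting the integral at \<open>T\<close>, the characteristic
  function \<open>\<phi>\<close> of \<open>X\<close> satisfies
  \<open>\<phi>(u) = exp (\<integral>\<^sub>0\<^sup>T \<psi>(u exp (-x)) dx) \<phi>(u exp (-T))\<close>. Hence \<open>\<phi>\<close> has no zeros, and differentiating
  at \<open>T = 0\<close> gives \<open>\<psi> = u \<phi>' / \<phi>\<close>, which is smooth since \<open>X\<close> has all moments.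

  Formally, \<open>K F = u F'\<close> with \<open>F\<close> the Taylor series of \<open>\<phi>\<close>. This recursion makes \<open>F\<close> converge
  wherever \<open>K\<close> does, and convergence of the moment series forces \<open>\<phi> = F\<close> there.
\<close>

section \<open>Taylor series of smooth functions\<close>

text \<open>
  Unlike \<^term>\<open>has_taylor_fps\<close>, this recursive form is preserved by products and reciprocals by
  plain induction on the order, without formulas for higher derivatives.
\<close>

primrec taylor_upto :: "nat \<Rightarrow> (real \<Rightarrow> complex) \<Rightarrow> complex fps \<Rightarrow> bool" where
  "taylor_upto 0 f F \<longleftrightarrow> f 0 = fps_nth F 0"
| "taylor_upto (Suc k) f F \<longleftrightarrow> f 0 = fps_nth F 0 \<and>
     (\<exists>f'. (\<forall>x. (f has_vector_derivative f' x) (at x)) \<and> taylor_upto k f' (fps_deriv F))"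

lemma taylor_upto_at_0: "taylor_upto k f F \<Longrightarrow> f 0 = fps_nth F 0"
  by (cases k) auto

text \<open>The product rule leaves one factor undifferentiated, so inductions that start from order
  \<open>Suc k\<close> also need \<open>f\<close> itself at order \<open>k\<close>.\<close>

lemma taylor_upto_SucD: "taylor_upto (Suc k) f F \<Longrightarrow> taylor_upto k f F"
proof (induction k arbitrary: f F)
  case (Suc k)
  from Suc.prems obtain f' where "f 0 = fps_nth F 0"
    "\<forall>x. (f has_vector_derivative f' x) (at x)" "taylor_upto (Suc k) f' (fps_deriv F)"
    unfolding taylor_upto.simps(2)[of "Suc k"] by blast
  then show ?case
    using Suc.IH[of f' "fps_deriv F"] by auto
qed simp

lemma taylor_upto_add:
  "taylor_upto k f F \<Longrightarrow> taylor_upto k g G \<Longrightarrow> taylor_upto k (\<lambda>x. f x + g x) (F + G)"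
proof (induction k arbitrary: f F g G)
  case (Suc k)
  then obtain f' g' where
    f: "f 0 = fps_nth F 0" "\<forall>x. (f has_vector_derivative f' x) (at x)" "taylor_upto k f' (fps_deriv F)" and
    g: "g 0 = fps_nth G 0" "\<forall>x. (g has_vector_derivative g' x) (at x)" "taylor_upto k g' (fps_deriv G)"
    by auto
  have "\<forall>x. ((\<lambda>x. f x + g x) has_vector_derivative f' x + g' x) (at x)"
    using f(2) g(2) by (auto intro!: derivative_intros)
  moreover have "taylor_upto k (\<lambda>x. f' x + g' x) (fps_deriv (F + G))"
    using Suc.IH[OF f(3) g(3)] by simp
  ultimately show ?case
    using f(1) g(1) by (auto intro!: exI[of _ "\<lambda>x. f' x + g' x"])
qed simp

lemma taylor_upto_mult:
  "taylor_upto k f F \<Longrightarrow> taylor_upto k g G \<Longrightarrow> taylor_upto k (\<lambda>x. f x * g x) (F * G)"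
proof (induction k arbitrary: f F g G)
  case (Suc k)
  then obtain f' g' where
    f: "f 0 = fps_nth F 0" "\<forall>x. (f has_vector_derivative f' x) (at x)" "taylor_upto k f' (fps_deriv F)" and
    g: "g 0 = fps_nth G 0" "\<forall>x. (g has_vector_derivative g' x) (at x)" "taylor_upto k g' (fps_deriv G)"
    by auto
  have "\<forall>x. ((\<lambda>x. f x * g x) has_vector_derivative f x * g' x + f' x * g x) (at x)"
    using f(2) g(2) by (auto intro!: has_vector_derivative_mult)
  moreover have "taylor_upto k (\<lambda>x. f x * g' x + f' x * g x) (F * fps_deriv G + fps_deriv F * G)"
    by (intro taylor_upto_add Suc.IH f(3) g(3) Suc.prems[THEN taylor_upto_SucD])
  ultimately show ?case
    using f(1) g(1) by (auto intro!: exI[of _ "\<lambda>x. f x * g' x + f' x * g x"])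
qed simp

lemma taylor_upto_const: "taylor_upto k (\<lambda>x. c) (fps_const c)"
proof (induction k arbitrary: c)
  case (Suc k)
  show ?case using Suc[of 0] by (auto intro!: exI[of _ "\<lambda>x. 0"])
qed simp

lemma taylor_upto_of_real: "taylor_upto k complex_of_real fps_X"
proof (cases k)
  case (Suc k)
  have "(complex_of_real has_vector_derivative 1) (at x)" for x
    using has_vector_derivative_of_real[OF DERIV_ident] by simp
  then show ?thesis
    using taylor_upto_const[of k 1] Suc by (auto intro!: exI[of _ "\<lambda>x. 1"])
qed simp

text \<open>The derivative \<open>- f' / f\<^sup>2\<close> is a product of \<open>f'\<close> with
  two copies of the reciprocal, all available at order \<open>k\<close> by induction.\<close>

lemma taylor_upto_inverse:
  assumes "taylor_upto k f F" "\<And>x. f x \<noteq> 0"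
  shows "taylor_upto k (\<lambda>x. inverse (f x)) (inverse F)"
  using assms
proof (induction k arbitrary: f F)
  case (Suc k)
  then obtain f' where
    f: "f 0 = fps_nth F 0" "\<forall>x. (f has_vector_derivative f' x) (at x)" "taylor_upto k f' (fps_deriv F)"
    by auto
  \<comment> \<open>The sign is written as a constant factor so that the rules for products and
    constants apply directly.\<close>
  let ?g' = "\<lambda>x. (- 1) * (f' x * (inverse (f x) * inverse (f x)))"
  have F0: "fps_nth F 0 \<noteq> 0"
    using f(1) Suc.prems(2) by metis
  have "\<forall>x. ((\<lambda>x. inverse (f x)) has_vector_derivative ?g' x) (at x)"
  proof
    fix x
    have "(inverse has_field_derivative - (inverse (f x) * inverse (f x))) (at (f x))"
      using DERIV_inverse[of "f x" UNIV] Suc.prems(2)[of x] by (simp add: power2_eq_square)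
    from field_vector_diff_chain_at[OF f(2)[rule_format, of x] this]
    show "((\<lambda>x. inverse (f x)) has_vector_derivative ?g' x) (at x)"
      by (simp add: o_def mult.commute)
  qed
  moreover have "taylor_upto k ?g' (fps_const (- 1) * (fps_deriv F * (inverse F * inverse F)))"
    by (intro taylor_upto_mult taylor_upto_const Suc.IH Suc.prems(2) f(3)
          Suc.prems(1)[THEN taylor_upto_SucD])
  moreover have "fps_const (- 1) * (fps_deriv F * (inverse F * inverse F)) = fps_deriv (inverse F)"
    using F0 by (subst fps_inverse_deriv) (simp_all add: power2_eq_square flip: fps_const_neg)
  ultimately show ?case
    using f(1) by (auto intro!: exI[of _ ?g'])
qed simp

lemma has_taylor_fps_imp_taylor_upto:
  assumes "has_taylor_fps f F"
  shows "taylor_upto k f F"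
proof -
  \<comment> \<open>Generalised to start at \<open>D n\<close>: the induction moves on to
    \<open>D (Suc n)\<close> and \<open>fps_deriv G\<close>.\<close>
  have "taylor_upto k (D n) G"
    if D: "\<And>n x. (D n has_vector_derivative D (Suc n) x) (at x)"
      and G: "\<And>m. fps_nth G m = D (n + m) 0 / fact m"
    for D :: "nat \<Rightarrow> real \<Rightarrow> complex" and n G
    using G
  proof (induction k arbitrary: n G)
    case 0
    then show ?case by simp
  next
    case (Suc k)
    have "fps_nth (fps_deriv G) m = D (Suc n + m) 0 / fact m" for m
      using Suc.prems[of "Suc m"] by (simp add: field_simps del: of_nat_Suc)
    from Suc.IH[OF this] show ?case
      using D Suc.prems[of 0] by auto
  qed
  from this[where n = 0 and G = F] assms show ?thesis
    unfolding has_taylor_fps_def by auto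
qed

text \<open>The derivative hidden in \<open>taylor_upto\<close> could depend on the order
  \<open>k\<close>. Uniqueness of derivatives identifies all these witnesses with
  \<open>V f\<close>, so iterating \<open>V\<close> gives a single sequence of derivatives.\<close>

lemma taylor_upto_imp_has_taylor_fps:
  assumes "\<And>k. taylor_upto k f F"
  shows "has_taylor_fps f F"
proof -
  define V :: "(real \<Rightarrow> complex) \<Rightarrow> real \<Rightarrow> complex"
    where "V g x = vector_derivative g (at x)" for g x
  have step: "(g has_vector_derivative V g x) (at x)" "taylor_upto k (V g) (fps_deriv G)"
    if g: "\<And>k. taylor_upto k g G" for g G x k
  proof -
    obtain g' where g': "\<forall>x. (g has_vector_derivative g' x) (at x)" "taylor_upto k g' (fps_deriv G)"
      using g[of "Suc k"] by auto
    then have "V g = g'"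
      unfolding V_def using vector_derivative_at by blast
    with g' show "(g has_vector_derivative V g x) (at x)" "taylor_upto k (V g) (fps_deriv G)"
      by auto
  qed
  have T: "taylor_upto k ((V ^^ n) f) ((fps_deriv ^^ n) F)" for n k
  proof (induction n arbitrary: k)
    case 0
    show ?case using assms by simp
  next
    case (Suc n)
    show ?case using step(2)[OF Suc] by simp
  qed
  show ?thesis
    unfolding has_taylor_fps_def
  proof (intro exI[of _ "\<lambda>n. (V ^^ n) f"] conjI allI)
    fix n x
    show "((V ^^ n) f has_vector_derivative (V ^^ Suc n) f x) (at x)"
      using step(1)[OF T[of _ n]] by simp
    show "fps_nth F n = (V ^^ n) f 0 / fact n"
      using taylor_upto_at_0[OF T[of 0 n]] fps_0th_higher_deriv[of n F] by simp
  qed simp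
qed

section \<open>The Hurwitz cumulant series\<close>

lemma fps_at_iu_mult: "fps_at_iu (F * G) = fps_at_iu F * fps_at_iu G"
proof (rule fps_ext)
  fix n
  have "\<i> ^ n = \<i> ^ i * \<i> ^ (n - i)" if "i \<le> n" for i
    using that by (simp flip: power_add)
  then show "fps_nth (fps_at_iu (F * G)) n = fps_nth (fps_at_iu F * fps_at_iu G) n"
    by (auto simp: fps_at_iu_def fps_mult_nth sum_distrib_right intro!: sum.cong)
qed

text \<open>The operator \<open>z d/dz\<close> multiplies the coefficient of order \<open>n\<close>
  by \<open>n\<close>, hence commutes with rescaling the variable. Plain differentiation would leave
  a factor \<open>\<i>\<close>.\<close>

lemma fps_at_iu_X_deriv: "fps_at_iu (fps_X * fps_deriv F) = fps_X * fps_deriv (fps_at_iu F)"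
  by (rule fps_ext) (auto simp: fps_at_iu_def)

text \<open>This is \<open>(log F)' = F' / F\<close> without the division. In this form it also
  serves as a coefficient recursion and can be evaluated at a point.\<close>

lemma hurwitz_cumulant_mult:
  assumes "f 0 = 1"
  defines "F \<equiv> Abs_fps (\<lambda>n. f n / fact n)"
  shows "hurwitz_cumulant f * F = fps_X * fps_deriv F"
proof -
  let ?A = "Abs_fps (\<lambda>n. if n = 0 then 0 else f n / fact n)"
  have FA: "F = 1 + ?A"
    unfolding F_def by (rule fps_ext) (auto simp: assms(1))
  have F0: "fps_nth F 0 = 1"
    by (simp add: F_def assms(1))
  have "fps_deriv (fps_ln 1 oo ?A) = (inverse (1 + fps_X) oo ?A) * fps_deriv ?A"
    by (simp add: fps_compose_deriv fps_ln_deriv)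
  also have "inverse (1 + fps_X) oo ?A = inverse (1 + ?A)"
    by (subst fps_inverse_compose) (auto simp: fps_compose_add_distrib)
  also have "fps_deriv ?A = fps_deriv F"
    by (simp add: FA)
  finally have "hurwitz_cumulant f * F = fps_X * fps_deriv F * (inverse F * F)"
    unfolding hurwitz_cumulant_def FA[symmetric] by (simp add: mult_ac)
  then show ?thesis
    using F0 by (simp add: inverse_mult_eq_1)
qed

text \<open>
  In \<open>n f\<^sub>n = (\<Sum>i\<le>n. k\<^sub>i f\<^sub>n\<^sub>-\<^sub>i)\<close> with \<open>k\<^sub>0 = 0\<close>, weighted by \<open>\<rho> ^ n\<close>, the right-hand side is at
  most the constant \<open>\<Sum>i. \<bar>k\<^sub>i\<bar> \<rho> ^ i\<close> times the largest of the earlier terms. Hence the terms stop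
  growing once \<open>n\<close> exceeds that constant.
\<close>

lemma fps_conv_radius_log_deriv_le:
  fixes F K :: "'a :: {banach, real_normed_field} fps"
  assumes eq: "K * F = fps_X * fps_deriv F" and F0: "fps_nth F 0 = 1"
  shows "fps_conv_radius K \<le> fps_conv_radius F"
proof (rule ccontr)
  assume "\<not> ?thesis"
  then have "fps_conv_radius F < fps_conv_radius K" by simp
  then obtain \<rho> where \<rho>: "fps_conv_radius F < ereal \<rho>" "ereal \<rho> < fps_conv_radius K"
    using ereal_dense2 by blast
  have "0 \<le> fps_conv_radius F"
    by (simp add: fps_conv_radius_def conv_radius_nonneg)
  then have \<rho>0: "\<rho> > 0"
    using \<rho>(1) by (metis ereal_less(2) le_less_trans)
  define \<kappa> where "\<kappa> n = norm (fps_nth K n) * \<rho> ^ n" for n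
  define g where "g n = norm (fps_nth F n) * \<rho> ^ n" for n
  have \<kappa>_nonneg: "\<kappa> n \<ge> 0" and g_nonneg: "g n \<ge> 0" for n
    using \<rho>0 by (auto simp: \<kappa>_def g_def)
  have "summable (\<lambda>n. norm (fps_nth K n * of_real \<rho> ^ n))"
    using \<rho> \<rho>0 by (intro abs_summable_in_conv_radius) (auto simp: fps_conv_radius_def)
  then have \<kappa>_sum: "summable \<kappa>"
    using \<rho>0 by (simp add: \<kappa>_def[abs_def] norm_mult norm_power)
  define A where "A = suminf \<kappa>"
  have K0: "fps_nth K 0 = 0"
    using arg_cong[OF eq, of "\<lambda>G. fps_nth G 0"] F0 by simp
  have rec: "of_nat n * fps_nth F n = (\<Sum>i\<in>{1..n}. fps_nth K i * fps_nth F (n - i))" for n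
  proof -
    have "of_nat n * fps_nth F n = fps_nth (K * F) n"
      unfolding eq by (cases n) auto
    also have "\<dots> = (\<Sum>i\<in>{0..n}. fps_nth K i * fps_nth F (n - i))"
      by (simp add: fps_mult_nth)
    also have "\<dots> = (\<Sum>i\<in>{1..n}. fps_nth K i * fps_nth F (n - i))"
      by (rule sum.mono_neutral_right) (auto simp: K0 Suc_le_eq)
    finally show ?thesis .
  qed
  have grow: "real n * g n \<le> A * B" if B: "\<And>m. m < n \<Longrightarrow> g m \<le> B" "B \<ge> 0" for n B
  proof -
    have "real n * g n = norm (of_nat n * fps_nth F n) * \<rho> ^ n"
      by (simp add: g_def norm_mult)
    also have "\<dots> \<le> (\<Sum>i\<in>{1..n}. norm (fps_nth K i * fps_nth F (n - i))) * \<rho> ^ n"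
      unfolding rec using \<rho>0 by (intro mult_right_mono norm_sum) auto
    also have "\<dots> = (\<Sum>i\<in>{1..n}. \<kappa> i * g (n - i))"
      unfolding sum_distrib_right
    proof (rule sum.cong)
      fix i assume "i \<in> {1..n}"
      then have "\<rho> ^ n = \<rho> ^ i * \<rho> ^ (n - i)"
        by (simp flip: power_add)
      then show "norm (fps_nth K i * fps_nth F (n - i)) * \<rho> ^ n = \<kappa> i * g (n - i)"
        by (simp add: \<kappa>_def g_def norm_mult)
    qed simp
    also have "\<dots> \<le> (\<Sum>i\<in>{1..n}. \<kappa> i * B)"
      using B \<kappa>_nonneg by (intro sum_mono mult_left_mono) auto
    also have "\<dots> = (\<Sum>i\<in>{1..n}. \<kappa> i) * B"
      by (simp add: sum_distrib_right)
    also have "\<dots> \<le> A * B"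
      unfolding A_def using \<kappa>_sum \<kappa>_nonneg B(2) by (intro mult_right_mono sum_le_suminf) auto
    finally show ?thesis .
  qed
  define n0 where "n0 = Suc (nat \<lceil>A\<rceil>)"
  have n0: "real n \<ge> A" "n > 0" if "n \<ge> n0" for n
    using that unfolding n0_def by linarith+
  define B where "B = Max (g ` {..n0})"
  have gB: "g n \<le> B" if "n \<le> n0" for n
    unfolding B_def using that by (intro Max_ge) auto
  have B0: "B \<ge> 0"
    using gB[of 0] g_nonneg[of 0] by linarith
  have bound: "g n \<le> B" for n
  proof (induction n rule: less_induct)
    case (less n)
    show ?case
    proof (cases "n \<le> n0")
      case False
      have "real n * g n \<le> A * B"
        using grow less B0 by blast
      also have "\<dots> \<le> real n * B"
        using n0[of n] False B0 by (intro mult_right_mono) auto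
      finally show ?thesis
        using n0[of n] False by simp
    qed (use gB in auto)
  qed
  \<comment> \<open>A second radius strictly below \<open>\<rho>\<close>: terms bounded at
    \<open>\<rho>\<close> are dominated by a geometric series at \<open>\<sigma>\<close>, so
    \<open>F\<close> would converge beyond its own radius.\<close>
  obtain \<sigma> where \<sigma>: "fps_conv_radius F < ereal \<sigma>" "\<sigma> < \<rho>"
    using ereal_dense2[OF \<rho>(1)] by auto
  have \<sigma>0: "\<sigma> > 0"
    using \<sigma>(1) \<open>0 \<le> fps_conv_radius F\<close> by (metis ereal_less(2) le_less_trans)
  have "summable (\<lambda>n. fps_nth F n * of_real \<sigma> ^ n)"
  proof (rule summable_comparison_test)
    show "summable (\<lambda>n. B * (\<sigma> / \<rho>) ^ n)"
      using \<sigma> \<sigma>0 by (intro summable_mult summable_geometric) auto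
    show "\<exists>N. \<forall>n\<ge>N. norm (fps_nth F n * of_real \<sigma> ^ n) \<le> B * (\<sigma> / \<rho>) ^ n"
    proof (intro exI[of _ 0] allI impI)
      fix n
      have "norm (fps_nth F n * of_real \<sigma> ^ n) = g n * (\<sigma> / \<rho>) ^ n"
        using \<rho>0 \<sigma>0 by (simp add: g_def norm_mult norm_power power_divide)
      also have "\<dots> \<le> B * (\<sigma> / \<rho>) ^ n"
        using bound \<rho>0 \<sigma>0 by (intro mult_right_mono) auto
      finally show "norm (fps_nth F n * of_real \<sigma> ^ n) \<le> B * (\<sigma> / \<rho>) ^ n" .
    qed
  qed
  then have "norm (of_real \<sigma> :: 'a) \<le> fps_conv_radius F"
    unfolding fps_conv_radius_def by (rule conv_radius_geI)
  then show False
    using \<sigma> \<sigma>0 by simp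
qed

section \<open>Characteristic functions with all moments\<close>

context real_distribution begin

lemma integrable_moment_iexp:
  assumes "integrable M (\<lambda>x. x ^ n)"
  shows "integrable M (\<lambda>x. (\<i> * complex_of_real x) ^ n * iexp (u * x))"
  using assms
  by (rule Bochner_Integration.integrable_bound)
     (auto simp: norm_mult norm_power power_abs)

text \<open>Differentiation under the integral. The remainder of \<open>iexp (h * x)\<close> after
  the linear term is at most \<open>(h * x)\<^sup>2 / 2\<close>, so the absolute moment of order
  \<open>n + 2\<close> bounds the error of the difference quotient by a multiple of
  \<open>\<bar>h\<bar>\<close>.\<close>

lemma moment_iexp_has_vector_derivative:
  assumes mom: "\<And>n. integrable M (\<lambda>x. x ^ n)"
  shows "((\<lambda>u. CLINT x|M. (\<i> * complex_of_real x) ^ n * iexp (u * x)) has_vector_derivative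
           (CLINT x|M. (\<i> * complex_of_real x) ^ Suc n * iexp (u * x))) (at u)"
proof -
  define D :: "nat \<Rightarrow> real \<Rightarrow> complex"
    where "D n u = (CLINT x|M. (\<i> * complex_of_real x) ^ n * iexp (u * x))" for n u
  define B where "B = (\<integral>x. \<bar>x\<bar> ^ (n + 2) \<partial>M)"
  have int_abs: "integrable M (\<lambda>x. \<bar>x\<bar> ^ (n + 2))"
    unfolding power_abs[symmetric] by (intro integrable_abs mom)
  note int = integrable_moment_iexp[OF mom]
  have bound: "norm (D n (u + h) - D n u - h *\<^sub>R D (Suc n) u) \<le> h\<^sup>2 / 2 * B" for h
  proof -
    have "D n (u + h) - D n u - h *\<^sub>R D (Suc n) u =
        (CLINT x|M. (\<i> * complex_of_real x) ^ n * iexp (u * x) * (iexp (h * x) - 1 - \<i> * (h * x)))"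
      (is "_ = integral\<^sup>L M ?r")
    proof -
      have "D n (u + h) - D n u - h *\<^sub>R D (Suc n) u =
        (CLINT x|M. (\<i> * complex_of_real x) ^ n * iexp ((u + h) * x)
            - (\<i> * complex_of_real x) ^ n * iexp (u * x)
            - h *\<^sub>R ((\<i> * complex_of_real x) ^ Suc n * iexp (u * x)))"
        unfolding D_def
        by (simp only: Bochner_Integration.integral_diff integral_scaleR_right
              Bochner_Integration.integrable_diff integrable_scaleR_right int)
      also have "\<dots> = integral\<^sup>L M ?r"
        by (intro Bochner_Integration.integral_cong)
           (auto simp: algebra_simps exp_add scaleR_conv_of_real)
      finally show ?thesis .
    qed
    also have "norm \<dots> \<le> (\<integral>x. h\<^sup>2 / 2 * \<bar>x\<bar> ^ (n + 2) \<partial>M)"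
    proof (rule order_trans[OF integral_norm_bound integral_mono])
      \<comment> \<open>Integrability is read off the expanded form, a combination of integrable
        terms; the factored form \<open>?r\<close> serves only the estimate.\<close>
      have "integrable M (\<lambda>x. (\<i> * complex_of_real x) ^ n * iexp ((u + h) * x)
            - (\<i> * complex_of_real x) ^ n * iexp (u * x)
            - h *\<^sub>R ((\<i> * complex_of_real x) ^ Suc n * iexp (u * x)))"
        using int by (intro Bochner_Integration.integrable_diff integrable_scaleR_right)
      also have "(\<lambda>x. (\<i> * complex_of_real x) ^ n * iexp ((u + h) * x)
            - (\<i> * complex_of_real x) ^ n * iexp (u * x)
            - h *\<^sub>R ((\<i> * complex_of_real x) ^ Suc n * iexp (u * x))) = ?r"
        by (auto simp: algebra_simps exp_add scaleR_conv_of_real)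
      finally show "integrable M (\<lambda>x. norm (?r x))"
        by (rule integrable_norm)
      show "integrable M (\<lambda>x. h\<^sup>2 / 2 * \<bar>x\<bar> ^ (n + 2))"
        using int_abs by (rule integrable_mult_right)
      fix x
      have "cmod (iexp (h * x) - 1 - \<i> * (h * x)) \<le> \<bar>h * x\<bar>\<^sup>2 / 2"
        using iexp_approx1[of "h * x" 1] by (simp add: power2_eq_square algebra_simps)
      then have "norm (?r x) \<le> \<bar>x\<bar> ^ n * (\<bar>h * x\<bar>\<^sup>2 / 2)"
        unfolding norm_mult[of _ "iexp (h * x) - _ - _"]
        by (intro mult_mono) (auto simp: norm_mult norm_power)
      also have "\<dots> = h\<^sup>2 / 2 * \<bar>x\<bar> ^ (n + 2)"
        by (simp add: power_mult_distrib power_add power2_eq_square)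
      finally show "norm (?r x) \<le> h\<^sup>2 / 2 * \<bar>x\<bar> ^ (n + 2)" .
    qed
    finally show ?thesis
      by (simp add: B_def)
  qed
  have "(\<lambda>h. norm (D n (u + h) - D n u - h *\<^sub>R D (Suc n) u) / norm h) \<midarrow>0\<rightarrow> 0"
  proof (rule Lim_null_comparison)
    show "\<forall>\<^sub>F h in at 0. norm (norm (D n (u + h) - D n u - h *\<^sub>R D (Suc n) u) / norm h) \<le> \<bar>h\<bar> / 2 * B"
    proof (rule always_eventually, rule allI)
      fix h :: real
      have "norm (D n (u + h) - D n u - h *\<^sub>R D (Suc n) u) / \<bar>h\<bar> \<le> (h\<^sup>2 / 2 * B) / \<bar>h\<bar>"
        by (intro divide_right_mono bound) auto
      also have "(h\<^sup>2 / 2 * B) / \<bar>h\<bar> = \<bar>h\<bar> / 2 * B"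
        by (simp add: power2_eq_square abs_if)
      finally show "norm (norm (D n (u + h) - D n u - h *\<^sub>R D (Suc n) u) / norm h) \<le> \<bar>h\<bar> / 2 * B"
        by simp
    qed
    show "(\<lambda>h. \<bar>h\<bar> / 2 * B) \<midarrow>0\<rightarrow> 0"
      by (auto intro!: tendsto_eq_intros)
  qed
  then show ?thesis
    unfolding has_vector_derivative_def has_derivative_at D_def
    by (simp add: bounded_linear_scaleR_left)
qed

lemma char_has_taylor_fps:
  assumes mom: "\<And>n. integrable M (\<lambda>x. x ^ n)"
  shows "has_taylor_fps (char M) (fps_at_iu (Abs_fps (\<lambda>n. expectation (\<lambda>x. x ^ n) / fact n)))"
  unfolding has_taylor_fps_def
proof (intro exI[of _ "\<lambda>n u. CLINT x|M. (\<i> * complex_of_real x) ^ n * iexp (u * x)"] conjI allI)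
  show "(\<lambda>u. CLINT x|M. (\<i> * complex_of_real x) ^ 0 * iexp (u * x)) = char M"
    by (auto simp: char_def)
  fix n
  have "(CLINT x|M. (\<i> * complex_of_real x) ^ n * iexp (0 * x)) = (CLINT x|M. \<i> ^ n * complex_of_real (x ^ n))"
    by (simp add: power_mult_distrib)
  also have "\<dots> = \<i> ^ n * complex_of_real (expectation (\<lambda>x. x ^ n))"
    by (simp only: integral_mult_right_zero integral_complex_of_real)
  finally show "fps_nth (fps_at_iu (Abs_fps (\<lambda>n. expectation (\<lambda>x. x ^ n) / fact n))) n =
      (CLINT x|M. (\<i> * complex_of_real x) ^ n * iexp (0 * x)) / fact n"
    by (simp add: fps_at_iu_def)
qed (rule moment_iexp_has_vector_derivative[OF mom])

text \<open>
  Even truncation orders are used because then the remainder \<open>2 \<bar>u\<bar> ^ n / n! E \<bar>X\<bar> ^ n\<close> is twice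
  the modulus of a term of the convergent series.
\<close>

lemma char_eq_eval_fps:
  assumes mom: "\<And>n. integrable M (\<lambda>x. x ^ n)"
  defines "F \<equiv> fps_at_iu (Abs_fps (\<lambda>n. expectation (\<lambda>x. x ^ n) / fact n))"
  assumes u: "ereal \<bar>u\<bar> < fps_conv_radius F"
  shows "char M u = eval_fps F (complex_of_real u)"
proof -
  define a where "a n = fps_nth F n * complex_of_real u ^ n" for n
  have F_nth: "fps_nth F n = \<i> ^ n * complex_of_real (expectation (\<lambda>x. x ^ n)) / fact n" for n
    by (simp add: F_def fps_at_iu_def)
  have summ: "summable a"
    unfolding a_def using u by (intro summable_fps) auto
  have sub: "strict_mono (\<lambda>n::nat. 2 * n)"
    by (simp add: strict_mono_def)
  have "(\<lambda>n. \<Sum>k\<le>n. a k) \<longlonglongrightarrow> suminf a"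
    using summ by (rule summable_LIMSEQ')
  from LIMSEQ_subseq_LIMSEQ[OF this sub]
  have 1: "(\<lambda>n. \<Sum>k\<le>2 * n. a k) \<longlonglongrightarrow> suminf a"
    by (simp add: o_def)
  have "(\<lambda>n. char M u - (\<Sum>k\<le>2 * n. a k)) \<longlonglongrightarrow> 0"
  proof (rule Lim_null_comparison)
    show "\<forall>\<^sub>F n in sequentially. norm (char M u - (\<Sum>k\<le>2 * n. a k)) \<le> 2 * norm (a (2 * n))"
    proof (rule always_eventually, rule allI)
      fix n
      have "norm (char M u - (\<Sum>k\<le>2 * n. a k)) \<le> 2 * \<bar>u\<bar> ^ (2 * n) / fact (2 * n) * expectation (\<lambda>x. \<bar>x\<bar> ^ (2 * n))"
        using char_approx1[of "2 * n" u] mom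
        by (simp add: a_def F_nth power_mult_distrib mult_ac)
      also have "expectation (\<lambda>x. \<bar>x\<bar> ^ (2 * n)) = \<bar>expectation (\<lambda>x. x ^ (2 * n))\<bar>"
        by (simp add: power_even_abs integral_nonneg_AE)
      also have "2 * \<bar>u\<bar> ^ (2 * n) / fact (2 * n) * \<dots> = 2 * norm (a (2 * n))"
        by (simp add: a_def F_nth norm_mult norm_power norm_divide)
      finally show "norm (char M u - (\<Sum>k\<le>2 * n. a k)) \<le> 2 * norm (a (2 * n))" .
    qed
    show "(\<lambda>n. 2 * norm (a (2 * n))) \<longlonglongrightarrow> 0"
      using LIMSEQ_subseq_LIMSEQ[OF summable_LIMSEQ_zero[OF summ] sub]
      by (intro tendsto_mult_right_zero tendsto_norm_zero) (simp add: o_def)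
  qed
  from tendsto_diff[OF tendsto_const[of "char M u"] this]
  have "(\<lambda>n. \<Sum>k\<le>2 * n. a k) \<longlonglongrightarrow> char M u"
    by simp
  with 1 have "char M u = suminf a"
    by (intro LIMSEQ_unique)
  then show ?thesis
    by (simp add: eval_fps_def a_def[abs_def])
qed

end

section \<open>Riemann sums\<close>

text \<open>Each cell of length \<open>h\<close> costs at most \<open>h * e\<close>. The endpoint
  \<open>real n * h\<close> moves while \<open>T\<close> stays fixed, so that the induction can add
  one cell at a time.\<close>

lemma riemann_sum_error:
  fixes g :: "real \<Rightarrow> 'a :: banach"
  assumes cont: "continuous_on {0..T} g" and h: "0 \<le> h" "real n * h \<le> T"
    and osc: "\<And>x y. x \<in> {0..T} \<Longrightarrow> y \<in> {0..T} \<Longrightarrow> \<bar>y - x\<bar> \<le> h \<Longrightarrow> norm (g y - g x) \<le> e"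
  shows "norm ((\<Sum>k<n. h *\<^sub>R g (real k * h)) - integral {0..real n * h} g) \<le> real n * h * e"
  using h(2)
proof (induction n)
  case (Suc n)
  define a b where "a = real n * h" and "b = real (Suc n) * h"
  have ab: "0 \<le> a" "a \<le> b" "b \<le> T" "b - a = h"
    using Suc.prems h(1) by (auto simp: a_def b_def algebra_simps)
  have int: "g integrable_on {c..d}" if "0 \<le> c" "d \<le> T" for c d
    using that by (intro integrable_continuous_real continuous_on_subset[OF cont]) auto
  have split: "integral {0..b} g = integral {0..a} g + integral {a..b} g"
    using ab int by (intro Henstock_Kurzweil_Integration.integral_combine[symmetric]) auto
  have "h *\<^sub>R g a - integral {a..b} g = integral {a..b} (\<lambda>x. g a - g x)"
    using ab int by (subst Henstock_Kurzweil_Integration.integral_diff) auto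
  also have "norm \<dots> \<le> e * (b - a)"
  proof (rule integral_bound)
    show "continuous_on {a..b} (\<lambda>x. g a - g x)"
      using ab by (intro continuous_intros continuous_on_subset[OF cont]) auto
    show "norm (g a - g x) \<le> e" if "x \<in> {a..b}" for x
      using that ab by (intro osc) auto
  qed (use ab in auto)
  finally have "norm (h *\<^sub>R g a - integral {a..b} g) \<le> h * e"
    using ab by (simp add: mult.commute)
  moreover have "norm ((\<Sum>k<n. h *\<^sub>R g (real k * h)) - integral {0..a} g) \<le> a * e"
    using Suc.IH ab by (simp add: a_def)
  ultimately have "norm (((\<Sum>k<n. h *\<^sub>R g (real k * h)) - integral {0..a} g)
      + (h *\<^sub>R g a - integral {a..b} g)) \<le> a * e + h * e"
    by (intro norm_triangle_le) linarith
  then show ?case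
    unfolding b_def[symmetric] split by (simp add: a_def b_def algebra_simps)
qed simp

lemma riemann_sum_tendsto:
  fixes g :: "real \<Rightarrow> 'a :: banach"
  assumes cont: "continuous_on {0..T} g" and T: "0 \<le> T"
  shows "(\<lambda>n. \<Sum>k<Suc n. (T / real (Suc n)) *\<^sub>R g (real k * (T / real (Suc n))))
           \<longlonglongrightarrow> integral {0..T} g"
proof (rule LIMSEQ_I)
  fix e :: real assume e: "0 < e"
  \<comment> \<open>Dividing by \<open>T + 1\<close> instead of \<open>T\<close> covers
    \<open>T = 0\<close> and keeps \<open>T * e' < e\<close> strict.\<close>
  define e' where "e' = e / (T + 1)"
  have e': "e' > 0" "T * e' < e"
    using e T by (auto simp: e'_def field_simps)
  have "uniformly_continuous_on {0..T} g"
    using cont by (intro compact_uniformly_continuous) auto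
  then obtain d where d: "d > 0"
    "\<And>x y. x \<in> {0..T} \<Longrightarrow> y \<in> {0..T} \<Longrightarrow> dist y x < d \<Longrightarrow> dist (g y) (g x) < e'"
    unfolding uniformly_continuous_on_def using e'(1) by metis
  have "(\<lambda>n. T / real (Suc n)) \<longlonglongrightarrow> 0"
    by real_asymp
  from order_tendstoD(2)[OF this d(1)]
  obtain n0 where n0: "\<And>n. n \<ge> n0 \<Longrightarrow> T / real (Suc n) < d"
    by (auto simp: eventually_sequentially)
  show "\<exists>n0. \<forall>n\<ge>n0. norm ((\<Sum>k<Suc n. (T / real (Suc n)) *\<^sub>R g (real k * (T / real (Suc n))))
      - integral {0..T} g) < e"
  proof (intro exI[of _ n0] allI impI)
    fix n assume "n \<ge> n0"
    then have small: "T / real (Suc n) < d" by (rule n0)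
    have eq: "real (Suc n) * (T / real (Suc n)) = T" by simp
    have "norm ((\<Sum>k<Suc n. (T / real (Suc n)) *\<^sub>R g (real k * (T / real (Suc n))))
        - integral {0..real (Suc n) * (T / real (Suc n))} g) \<le> real (Suc n) * (T / real (Suc n)) * e'"
    proof (rule riemann_sum_error[OF cont])
      fix x y assume "x \<in> {0..T}" "y \<in> {0..T}" "\<bar>y - x\<bar> \<le> T / real (Suc n)"
      then show "norm (g y - g x) \<le> e'"
        using d(2)[of x y] small by (auto simp: dist_norm)
    qed (use T in auto)
    then show "norm ((\<Sum>k<Suc n. (T / real (Suc n)) *\<^sub>R g (real k * (T / real (Suc n))))
        - integral {0..T} g) < e"
      unfolding eq using e'(2) by linarith
  qed
qed

section \<open>Continuous one-parameter semigroups\<close>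

text \<open>The fundamental theorem of calculus, with the integral kept as a factor because it may
  vanish. It recovers an exponent from the semigroup without taking a logarithm.\<close>

lemma exp_eq_imp_mult_integral:
  fixes a :: "real \<Rightarrow> complex"
  assumes a: "\<And>t. t \<ge> 0 \<Longrightarrow> a t = exp (of_real t * c)" and d: "d \<ge> 0"
  shows "c * integral {0..d} a = a d - 1"
proof -
  have "((\<lambda>t. exp (of_real t * c)) has_vector_derivative c * exp (of_real x * c)) (at x within {0..d})" for x
  proof -
    have "((\<lambda>t. exp (t * c)) has_field_derivative c * exp (of_real x * c)) (at (of_real x))"
      by (auto intro!: derivative_eq_intros)
    from has_vector_derivative_real_field[OF this] show ?thesis
      by (rule has_vector_derivative_at_within)
  qed
  from fundamental_theorem_of_calculus[OF d this]
  have "((\<lambda>x. c * exp (of_real x * c)) has_integral a d - 1) {0..d}"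
    using a[of d] d by simp
  then have "integral {0..d} (\<lambda>x. c * exp (of_real x * c)) = a d - 1"
    by (rule integral_unique)
  also have "integral {0..d} (\<lambda>x. c * exp (of_real x * c)) = integral {0..d} (\<lambda>x. c * a x)"
    using a by (intro Henstock_Kurzweil_Integration.integral_cong) auto
  finally show ?thesis by simp
qed

text \<open>Since \<open>a (s + h) - a s = a s * (a h - 1)\<close> and
  \<open>norm (a s) \<le> 1\<close>, the limit at \<open>0\<close> controls increments uniformly in
  \<open>s\<close>. Uniformity is what gives continuity from the left as well.\<close>

lemma contraction_semigroup_continuous_on:
  fixes a :: "real \<Rightarrow> complex"
  assumes a0: "a 0 = 1" and add: "\<And>s t. s \<ge> 0 \<Longrightarrow> t \<ge> 0 \<Longrightarrow> a (s + t) = a s * a t"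
    and le1: "\<And>t. t \<ge> 0 \<Longrightarrow> norm (a t) \<le> 1" and lim: "(a \<longlongrightarrow> 1) (at_right 0)"
  shows "continuous_on {0..} a"
  unfolding continuous_on_iff
proof (intro ballI allI impI)
  fix t e :: real assume t: "t \<in> {0..}" and e: "0 < e"
  obtain d where d: "d > 0" "\<And>h. 0 < h \<Longrightarrow> h < d \<Longrightarrow> dist (a h) 1 < e"
    using tendstoD[OF lim e] unfolding eventually_at_right_field by auto
  have step: "dist (a (s + h)) (a s) < e" if "s \<ge> 0" "h \<ge> 0" "h < d" for s h
  proof (cases "h = 0")
    case False
    have "dist (a (s + h)) (a s) = norm (a s) * norm (a h - 1)"
      using that by (simp add: add dist_norm algebra_simps flip: norm_mult)
    also have "\<dots> \<le> 1 * norm (a h - 1)"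
      using that by (intro mult_right_mono le1) auto
    also have "\<dots> < e"
      using d(2)[of h] that False by (simp add: dist_norm)
    finally show ?thesis .
  qed (use e in simp)
  show "\<exists>d>0. \<forall>x'\<in>{0..}. dist x' t < d \<longrightarrow> dist (a x') (a t) < e"
  proof (intro exI[of _ d] conjI ballI impI)
    fix x' assume "x' \<in> {0..}" "dist x' t < d"
    then show "dist (a x') (a t) < e"
      using step[of t "x' - t"] step[of x' "t - x'"] t
      by (cases "x' \<ge> t") (auto simp: dist_real_def dist_commute)
  qed (use d in auto)
qed

lemma integral_nonzero_near_0:
  fixes a :: "real \<Rightarrow> complex"
  assumes cont: "continuous_on {0..} a" and a0: "a 0 = 1"
  shows "\<exists>d>0. integral {0..d} a \<noteq> 0"
proof -
  obtain d where d: "d > 0" "\<And>h. 0 \<le> h \<Longrightarrow> h < d \<Longrightarrow> dist (a h) 1 < 1 / 2"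
    using cont a0 unfolding continuous_on_iff
    by (elim ballE[of _ _ 0] allE[of _ "1/2 :: real"]) (auto simp: dist_real_def)
  \<comment> \<open>Half of \<open>d\<close>, because the bound holds only for \<open>h < d\<close>
    and is wanted on a closed interval. There \<open>a\<close> stays within \<open>1 / 2\<close> of
    \<open>1\<close>, and so does its average.\<close>
  have ca: "continuous_on {0..d / 2} a"
    using cont by (rule continuous_on_subset) auto
  have "norm (integral {0..d / 2} (\<lambda>x. a x - 1)) \<le> 1 / 2 * (d / 2 - 0)"
  proof (rule integral_bound)
    show "continuous_on {0..d / 2} (\<lambda>x. a x - 1)"
      by (intro continuous_intros ca)
    show "norm (a x - 1) \<le> 1 / 2" if "x \<in> {0..d / 2}" for x
      using d(2)[of x] that d(1) by (auto simp: dist_norm)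
  qed (use d in auto)
  also have "integral {0..d / 2} (\<lambda>x. a x - 1) = integral {0..d / 2} a - of_real (d / 2)"
    using d(1) integrable_continuous_real[OF ca]
    by (subst Henstock_Kurzweil_Integration.integral_diff) (auto simp: scaleR_conv_of_real)
  finally have "integral {0..d / 2} a \<noteq> 0"
    using d(1) by (auto simp: norm_mult norm_divide)
  then show ?thesis
    using d(1) by (intro exI[of _ "d / 2"]) auto
qed

text \<open>Averaging over a window \<open>[s, s + d]\<close> shows that a continuous semigroup is differentiable.\<close>

lemma continuous_semigroup_exp:
  fixes a :: "real \<Rightarrow> complex"
  assumes a0: "a 0 = 1" and add: "\<And>s t. s \<ge> 0 \<Longrightarrow> t \<ge> 0 \<Longrightarrow> a (s + t) = a s * a t"
    and cont: "continuous_on {0..} a"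
  shows "\<exists>c. \<forall>t\<ge>0. a t = exp (of_real t * c)"
proof -
  obtain d where d: "d > 0" "integral {0..d} a \<noteq> 0"
    using integral_nonzero_near_0[OF cont a0] by blast
  define A where "A t = integral {0..t} a" for t
  \<comment> \<open>Differentiating the averaged formula for \<open>a\<close> gives
    \<open>(a (s + d) - a s) / A d = a s * (a d - 1) / A d\<close>, which dictates this
    value.\<close>
  define c where "c = (a d - 1) / A d"
  have ca: "continuous_on {x..y} a" if "x \<ge> 0" for x y
    using cont by (rule continuous_on_subset) (use that in auto)
  have eq: "a s = (A (s + d) - A s) / A d" if "s \<ge> 0" for s
  proof -
    have "a s * A d = integral {0..d} (\<lambda>x. a s * a x)"
      unfolding A_def by simp
    also have "\<dots> = integral {0..d} (a \<circ> (\<lambda>x. x + s))"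
      using that by (intro Henstock_Kurzweil_Integration.integral_cong) (auto simp: add mult.commute)
    also have "\<dots> = integral {0 + s..d + s} a"
      by (rule integral_shift) (use that in \<open>auto intro: ca\<close>)
    also have "\<dots> = A (s + d) - A s"
      using Henstock_Kurzweil_Integration.integral_combine[of 0 s "s + d" a] that d(1)
        integrable_continuous_real[OF ca[of 0]]
      by (simp add: A_def algebra_simps)
    finally show ?thesis
      using d(2) by (simp add: A_def field_simps)
  qed
  have "a t = exp (of_real t * c)" if t: "t \<ge> 0" for t
  proof -
    have A_deriv: "(A has_vector_derivative a x) (at x within {0..y})" if "x \<in> {0..y}" for x y
      unfolding A_def by (rule integral_has_vector_derivative) (use that in \<open>auto intro: ca\<close>)
    have a_deriv: "(a has_vector_derivative c * a s) (at s within {0..t})" if s: "s \<in> {0..t}" for s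
    proof -
      have "((\<lambda>s. s + d) has_vector_derivative 1) (at s within {0..t})"
        by (auto intro!: derivative_eq_intros)
      moreover have "(A has_vector_derivative a (s + d)) (at (s + d) within (\<lambda>s. s + d) ` {0..t})"
        by (rule has_vector_derivative_within_subset[OF A_deriv[of _ "t + d"]]) (use s d in auto)
      ultimately have "(A \<circ> (\<lambda>s. s + d) has_vector_derivative 1 *\<^sub>R a (s + d)) (at s within {0..t})"
        by (rule vector_diff_chain_within)
      then have "((\<lambda>s. (A (s + d) - A s) / A d) has_vector_derivative (a (s + d) - a s) / A d) (at s within {0..t})"
        using A_deriv[OF s] by (auto simp: o_def intro!: derivative_eq_intros)
      also have "(a (s + d) - a s) / A d = c * a s"
        using add[of s d] s d by (simp add: c_def field_simps)
      finally show ?thesis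
        by (rule has_vector_derivative_transform[OF s, rotated]) (auto simp: eq)
    qed
    obtain k where k: "\<And>s. s \<in> {0..t} \<Longrightarrow> a s * exp (- (of_real s * c)) = k"
    proof (rule has_vector_derivative_zero_constant)
      fix s assume s: "s \<in> {0..t}"
      have "((\<lambda>z. exp (- (z * c))) has_field_derivative - c * exp (- (of_real s * c))) (at (of_real s))"
        by (auto intro!: derivative_eq_intros)
      then have "((\<lambda>s. exp (- (of_real s * c))) has_vector_derivative - c * exp (- (of_real s * c))) (at s within {0..t})"
        by (rule has_vector_derivative_at_within[OF has_vector_derivative_real_field])
      from has_vector_derivative_mult[OF a_deriv[OF s] this]
      show "((\<lambda>s. a s * exp (- (of_real s * c))) has_vector_derivative 0) (at s within {0..t})"
        by (simp add: algebra_simps)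
    qed auto
    from k[of 0] k[of t] t
    have "a t * exp (- (of_real t * c)) = 1"
      by (simp add: a0)
    then show ?thesis
      by (simp add: exp_minus field_simps)
  qed
  then show ?thesis by blast
qed

section \<open>Levy exponents and the random integral\<close>

text \<open>Two continuous branches differ by a continuous function with values in the integer
  multiples of \<open>2 * pi * \<i>\<close>. Such a function is constant, and the value at
  \<open>0\<close> makes it zero.\<close>

lemma char_exponent_eqI:
  assumes "continuous_on UNIV C" "C 0 = 0" "\<And>u. exp (C u) = char \<mu> u"
  shows "char_exponent \<mu> = C"
  unfolding char_exponent_def
proof (rule the_equality)
  fix C' assume C': "continuous_on UNIV C' \<and> C' 0 = 0 \<and> (\<forall>u. exp (C' u) = char \<mu> u)"
  have period: "\<exists>k :: int. C' u - C u = of_int (2 * k) * of_real pi * \<i>" for u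
  proof -
    have "exp (C' u) = exp (C u)"
      using C' assms by simp
    then obtain k :: int where "C' u = C u + (of_int (2 * k) * pi) * \<i>"
      unfolding exp_eq by blast
    then show ?thesis by auto
  qed
  have "(\<lambda>u. C' u - C u) constant_on UNIV"
  proof (rule continuous_discrete_range_constant)
    show "continuous_on UNIV (\<lambda>u. C' u - C u)"
      using C' assms by (intro continuous_intros) auto
    fix x :: real
    show "\<exists>e>0. \<forall>y. y \<in> UNIV \<and> C' y - C y \<noteq> C' x - C x \<longrightarrow> e \<le> norm (C' y - C y - (C' x - C x))"
    proof (intro exI[of _ "2 * pi"] conjI allI impI)
      fix y assume ne: "y \<in> UNIV \<and> C' y - C y \<noteq> C' x - C x"
      obtain k l :: int where
        kl: "C' y - C y = of_int (2 * k) * of_real pi * \<i>" "C' x - C x = of_int (2 * l) * of_real pi * \<i>"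
        using period by blast
      have "C' y - C y - (C' x - C x) = of_real (2 * pi * of_int (k - l)) * \<i>"
        unfolding kl by (simp add: algebra_simps)
      then have "norm (C' y - C y - (C' x - C x)) = 2 * pi * of_int \<bar>k - l\<bar>"
        by (simp add: norm_mult abs_mult del: of_real_mult of_real_diff)
      moreover have "k \<noteq> l" using ne kl by auto
      then have "(1 :: real) \<le> of_int \<bar>k - l\<bar>" by linarith
      ultimately show "2 * pi \<le> norm (C' y - C y - (C' x - C x))"
        using mult_left_mono[of 1 "of_int \<bar>k - l\<bar>" "2 * pi"] by simp
    qed simp
  qed simp
  then obtain z where z: "\<And>u. C' u - C u = z"
    unfolding constant_on_def by auto
  from z[of 0] C' assms(2) have "z = 0" by simp
  with z show "C' = C" by (auto simp: fun_eq_iff)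
qed (use assms in auto)

section \<open>Characteristic functions of a Levy process\<close>

locale levy = prob_space N for N :: "'b measure" +
  fixes Z :: "real \<Rightarrow> 'b \<Rightarrow> real"
  assumes levy: "levy_process N Z"
begin

definition phi :: "real \<Rightarrow> real \<Rightarrow> complex" where
  "phi t u = char (distr N borel (Z t)) u"

lemma measurable_Z [measurable]: "0 \<le> t \<Longrightarrow> Z t \<in> borel_measurable N"
  using levy by (auto simp: levy_process_def)

lemma AE_Z_0: "AE \<omega> in N. Z 0 \<omega> = 0"
  using levy by (auto simp: levy_process_def)

lemma phi_eq_expectation:
  assumes "0 \<le> t"
  shows "phi t u = (CLINT \<omega>|N. iexp (u * Z t \<omega>))"
  using assms by (simp add: phi_def char_def integral_distr)

lemma phi_zero_right [simp]: "0 \<le> t \<Longrightarrow> phi t 0 = 1"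
  unfolding phi_def by (intro real_distribution.char_zero real_distribution_distr) simp

lemma norm_phi_le_1: "0 \<le> t \<Longrightarrow> norm (phi t u) \<le> 1"
  unfolding phi_def by (intro real_distribution.cmod_char_le_1 real_distribution_distr) simp

lemma isCont_phi: "0 \<le> t \<Longrightarrow> isCont (phi t) u"
  unfolding phi_def[abs_def] by (intro real_distribution.isCont_char real_distribution_distr) simp

lemma phi_zero_left [simp]: "phi 0 u = 1"
proof -
  have "phi 0 u = (CLINT \<omega>|N. 1)"
    unfolding phi_eq_expectation[OF order_refl]
    by (rule integral_cong_AE) (use AE_Z_0 in auto)
  then show ?thesis by (simp add: prob_space)
qed

text \<open>Stationarity compares with \<open>Z t - Z 0\<close>, and \<open>Z 0\<close> vanishes
  only almost surely, so the passage to \<open>Z t\<close> happens at the level of laws.\<close>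

lemma char_increment:
  assumes "0 \<le> r" "0 \<le> t"
  shows "char (distr N borel (\<lambda>\<omega>. Z (r + t) \<omega> - Z r \<omega>)) u = phi t u"
proof -
  have "distr N borel (\<lambda>\<omega>. Z (r + t) \<omega> - Z r \<omega>) = distr N borel (\<lambda>\<omega>. Z t \<omega> - Z 0 \<omega>)"
    using levy assms by (auto simp: levy_process_def)
  also have "\<dots> = distr N borel (Z t)"
    by (rule distr_cong_AE) (use AE_Z_0 assms in auto)
  finally show ?thesis by (simp add: phi_def)
qed

text \<open>Used twice: unit weights on two increments give the semigroup law, and exponential
  weights give the transforms of Riemann-Stieltjes sums.\<close>

lemma char_weighted_increments:
  assumes t: "0 \<le> t 0" "\<And>k. k < n \<Longrightarrow> t k < t (Suc k)"
  shows "char (distr N borel (\<lambda>\<omega>. \<Sum>k<n. c k * (Z (t (Suc k)) \<omega> - Z (t k) \<omega>))) u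
       = (\<Prod>k<n. phi (t (Suc k) - t k) (u * c k))"
proof -
  have nonneg: "0 \<le> t k" if "k \<le> n" for k
    using that
  proof (induction k)
    case (Suc k)
    then show ?case using t(2)[of k] by simp
  qed (use t in simp)
  have "indep_vars (\<lambda>_. borel) (\<lambda>k \<omega>. Z (t (Suc k)) \<omega> - Z (t k) \<omega>) {..<n}"
    using levy t by (auto simp: levy_process_def)
  then have "indep_vars (\<lambda>_. borel) (\<lambda>k \<omega>. c k * (Z (t (Suc k)) \<omega> - Z (t k) \<omega>)) {..<n}"
    by (rule indep_vars_compose2) simp
  then have "char (distr N borel (\<lambda>\<omega>. \<Sum>k<n. c k * (Z (t (Suc k)) \<omega> - Z (t k) \<omega>))) u
      = (\<Prod>k<n. char (distr N borel (\<lambda>\<omega>. c k * (Z (t (Suc k)) \<omega> - Z (t k) \<omega>))) u)"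
    by (rule char_distr_sum)
  also have "\<dots> = (\<Prod>k<n. phi (t (Suc k) - t k) (u * c k))"
  proof (rule prod.cong)
    fix k assume "k \<in> {..<n}"
    then have k: "0 \<le> t k" "0 \<le> t (Suc k)" "t k < t (Suc k)"
      using t nonneg by auto
    have "char (distr N borel (\<lambda>\<omega>. c k * (Z (t (Suc k)) \<omega> - Z (t k) \<omega>))) u
        = char (distr N borel (\<lambda>\<omega>. Z (t (Suc k)) \<omega> - Z (t k) \<omega>)) (u * c k)"
      using k by (simp add: char_def integral_distr mult.assoc)
    also have "\<dots> = phi (t (Suc k) - t k) (u * c k)"
      using char_increment[of "t k" "t (Suc k) - t k"] k by simp
    finally show "char (distr N borel (\<lambda>\<omega>. c k * (Z (t (Suc k)) \<omega> - Z (t k) \<omega>))) u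
        = phi (t (Suc k) - t k) (u * c k)" .
  qed simp
  finally show ?thesis .
qed

lemma phi_add:
  assumes "0 \<le> r" "0 \<le> t"
  shows "phi (r + t) u = phi r u * phi t u"
proof (cases "r = 0 \<or> t = 0")
  \<comment> \<open>Independence of increments is given along strictly increasing times, so
    \<open>r = 0\<close> and \<open>t = 0\<close> are split off and follow from
    \<open>phi 0 u = 1\<close>.\<close>
  case False
  with assms have pos: "0 < r" "0 < t" by auto
  define p :: "nat \<Rightarrow> real" where "p k = (if k = 0 then 0 else if k = 1 then r else r + t)" for k
  have "char (distr N borel (\<lambda>\<omega>. \<Sum>k<2. 1 * (Z (p (Suc k)) \<omega> - Z (p k) \<omega>))) u
      = (\<Prod>k<2. phi (p (Suc k) - p k) (u * 1))"
    by (rule char_weighted_increments) (use pos in \<open>auto simp: p_def\<close>)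
  then have "char (distr N borel (\<lambda>\<omega>. Z (0 + (r + t)) \<omega> - Z 0 \<omega>)) u = phi r u * phi t u"
    by (simp add: p_def numeral_2_eq_2)
  then show ?thesis
    using char_increment[of 0 "r + t" u] assms by simp
qed auto

text \<open>Dominated convergence concerns sequences, so the limit is tested along positive null
  sequences. The pointwise limit is right continuity of the paths at \<open>0\<close>.\<close>

lemma phi_tendsto_1: "((\<lambda>t. phi t u) \<longlongrightarrow> 1) (at_right 0)"
proof (rule tendsto_at_right_sequentially[of 0 1])
  fix S :: "nat \<Rightarrow> real"
  assume S: "\<And>n. 0 < S n" "S \<longlonglongrightarrow> 0"
  have S0: "filterlim S (at_right 0) sequentially"
    using S by (auto simp: filterlim_at less_imp_neq[symmetric])
  have nonneg: "0 \<le> S n" for n using S(1)[of n] by simp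
  have "AE \<omega> in N. cadlag (\<lambda>t. Z t \<omega>)"
    using levy by (auto simp: levy_process_def)
  then have lim: "AE \<omega> in N. (\<lambda>n. iexp (u * Z (S n) \<omega>)) \<longlonglongrightarrow> iexp (u * Z 0 \<omega>)"
  proof eventually_elim
    case (elim \<omega>)
    then have "((\<lambda>t. Z t \<omega>) \<longlongrightarrow> Z 0 \<omega>) (at_right 0)"
      by (auto simp: cadlag_def continuous_within)
    from filterlim_compose[OF this S0]
    show ?case by (intro tendsto_intros)
  qed
  have "(\<lambda>n. CLINT \<omega>|N. iexp (u * Z (S n) \<omega>)) \<longlonglongrightarrow> (CLINT \<omega>|N. iexp (u * Z 0 \<omega>))"
    by (rule integral_dominated_convergence[where w = "\<lambda>_. 1"]) (use lim nonneg in auto)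
  then show "(\<lambda>n. phi (S n) u) \<longlonglongrightarrow> 1"
    using phi_zero_left[of u] by (simp add: phi_eq_expectation nonneg del: phi_zero_left)
qed simp

section \<open>The Levy exponent and its continuity\<close>

lemma continuous_on_phi: "continuous_on {0..} (\<lambda>t. phi t u)"
  by (rule contraction_semigroup_continuous_on)
     (auto simp: phi_add norm_phi_le_1 phi_tendsto_1)

text \<open>Chosen separately for each \<open>u\<close>, so regularity in \<open>u\<close> is not
  built in; \<open>isCont_psi\<close> supplies it.\<close>

definition psi :: "real \<Rightarrow> complex" where
  "psi u = (SOME c. \<forall>t\<ge>0. phi t u = exp (of_real t * c))"

lemma phi_eq_exp: "0 \<le> t \<Longrightarrow> phi t u = exp (of_real t * psi u)"
  using someI_ex[OF continuous_semigroup_exp[of "\<lambda>t. phi t u"]]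
  by (auto simp: psi_def phi_add continuous_on_phi)

lemma psi_mult_integral: "0 \<le> d \<Longrightarrow> psi u * integral {0..d} (\<lambda>t. phi t u) = phi d u - 1"
  by (rule exp_eq_imp_mult_integral) (auto simp: phi_eq_exp)

text \<open>A single value \<open>phi t 0 = 1\<close> with \<open>t > 0\<close> fixes
  \<open>psi 0\<close> only up to multiples of \<open>2 * pi * \<i> / t\<close>; the integrated
  identity gives zero outright.\<close>

lemma psi_0 [simp]: "psi 0 = 0"
proof -
  have "integral {0..1} (\<lambda>t. phi t 0) = integral {0..1::real} (\<lambda>t. 1)"
    by (rule Henstock_Kurzweil_Integration.integral_cong) simp
  with psi_mult_integral[of 1 0] show ?thesis by simp
qed

lemma isCont_integral_phi: "isCont (\<lambda>u. integral {0..d} (\<lambda>t. phi t u)) u"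
  unfolding continuous_at_sequentially
proof safe
  fix X :: "nat \<Rightarrow> real" assume X: "X \<longlonglongrightarrow> u"
  show "((\<lambda>u. integral {0..d} (\<lambda>t. phi t u)) \<circ> X) \<longlonglongrightarrow> integral {0..d} (\<lambda>t. phi t u)"
    unfolding o_def
  proof (rule dominated_convergence(2)[where h = "\<lambda>_. 1"])
    show "(\<lambda>t. phi t (X k)) integrable_on {0..d}" for k
      by (intro integrable_continuous_real continuous_on_subset[OF continuous_on_phi]) auto
    show "(\<lambda>k. phi t (X k)) \<longlonglongrightarrow> phi t u" if "t \<in> {0..d}" for t
      using isCont_tendsto_compose[OF isCont_phi X] that by auto
  qed (auto simp: norm_phi_le_1)
qed

text \<open>Close to \<open>u\<close>, \<open>psi\<close> is a quotient of functions continuous in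
  the argument. The length \<open>d\<close> is chosen for this \<open>u\<close>, and continuity
  keeps the denominator nonzero nearby.\<close>

lemma isCont_psi: "isCont psi u"
proof -
  obtain d where d: "d > 0" "integral {0..d} (\<lambda>t. phi t u) \<noteq> 0"
    using integral_nonzero_near_0[OF continuous_on_phi] by auto
  let ?A = "\<lambda>u. integral {0..d} (\<lambda>t. phi t u)"
  have "isCont (\<lambda>u. (phi d u - 1) / ?A u) u"
    by (intro continuous_intros isCont_phi isCont_integral_phi) (use d in auto)
  moreover have "eventually (\<lambda>v. ?A v \<noteq> 0) (nhds u)"
    using isCont_integral_phi[of u d, unfolded isCont_def
        tendsto_at_iff_tendsto_nhds[of "?A" u]] d(2)
    by (rule tendsto_imp_eventually_ne)
  then have "eventually (\<lambda>v. (phi d v - 1) / ?A v = psi v) (nhds u)"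
    by eventually_elim (use psi_mult_integral[of d] d in \<open>simp add: field_simps\<close>)
  ultimately show ?thesis
    by (simp cong: isCont_cong)
qed

lemma continuous_on_psi: "continuous_on A psi"
  by (intro continuous_at_imp_continuous_on ballI isCont_psi)

text \<open>Continuity of \<open>psi\<close> and \<open>psi 0 = 0\<close> single out this logarithm
  as the distinguished one.\<close>

lemma char_exponent_Z:
  assumes "0 \<le> s"
  shows "char_exponent (distr N borel (Z s)) = (\<lambda>u. of_real s * psi u)"
  by (rule char_exponent_eqI)
     (auto intro!: continuous_intros continuous_on_psi simp: phi_eq_exp[OF assms, symmetric] phi_def)

section \<open>The random integral over a finite interval\<close>

definition RS_exponent :: "real \<Rightarrow> real \<Rightarrow> complex" where
  "RS_exponent T u = integral {0..T} (\<lambda>x. psi (u * exp (- x)))"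

lemma continuous_on_psi_exp: "continuous_on A (\<lambda>x. psi (u * exp (- x)))"
  by (intro continuous_on_compose2[OF continuous_on_psi[of UNIV]] continuous_intros) auto

text \<open>Shifting the variable by \<open>T\<close> multiplies the kernel \<open>exp (- x)\<close>
  by \<open>exp (- T)\<close>, which moves into the argument.\<close>

lemma RS_exponent_add:
  assumes "0 \<le> T" "0 \<le> S"
  shows "RS_exponent (T + S) u = RS_exponent T u + RS_exponent S (u * exp (- T))"
proof -
  have "RS_exponent S (u * exp (- T)) = integral {0..S} ((\<lambda>x. psi (u * exp (- x))) \<circ> (\<lambda>x. x + T))"
    unfolding RS_exponent_def
    by (rule Henstock_Kurzweil_Integration.integral_cong) (simp add: algebra_simps flip: exp_add)
  also have "\<dots> = integral {0 + T..S + T} (\<lambda>x. psi (u * exp (- x)))"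
    by (rule integral_shift) (rule continuous_on_psi_exp)
  finally show ?thesis
    unfolding RS_exponent_def
    using Henstock_Kurzweil_Integration.integral_combine[of 0 T "T + S" "\<lambda>x. psi (u * exp (- x))"]
      assms integrable_continuous_real[OF continuous_on_psi_exp]
    by (simp add: add.commute)
qed

text \<open>Left-endpoint tags on a uniform partition match the sums in
  \<open>riemann_sum_tendsto\<close>; \<open>Suc n\<close> cells keep the mesh meaningful at
  \<open>n = 0\<close>.\<close>

definition RS_sum :: "real \<Rightarrow> nat \<Rightarrow> 'b \<Rightarrow> real" where
  "RS_sum T n \<omega> = (\<Sum>k<Suc n. exp (- (real k * (T / real (Suc n)))) *
     (Z (real (Suc k) * (T / real (Suc n))) \<omega> - Z (real k * (T / real (Suc n))) \<omega>))"

lemma measurable_RS_sum [measurable]: "0 \<le> T \<Longrightarrow> RS_sum T n \<in> borel_measurable N"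
  unfolding RS_sum_def[abs_def] by measurable

text \<open>A cell of length \<open>h\<close> starting at \<open>x\<close> contributes the factor
  \<open>exp (h * psi (u * exp (- x)))\<close>, so the product is the exponential of a Riemann sum.
  \<open>T > 0\<close> makes the partition points strictly increasing.\<close>

lemma char_RS_sum_tendsto:
  assumes T: "0 < T"
  shows "(\<lambda>n. char (distr N borel (RS_sum T n)) u) \<longlonglongrightarrow> exp (RS_exponent T u)"
proof -
  have "char (distr N borel (RS_sum T n)) u =
      exp (\<Sum>k<Suc n. (T / real (Suc n)) *\<^sub>R psi (u * exp (- (real k * (T / real (Suc n))))))" for n
  proof -
    have eq: "real (Suc k) * (T / real (Suc n)) - real k * (T / real (Suc n)) = T / real (Suc n)" for k
      by (simp only: left_diff_distrib[symmetric]) simp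
    have "char (distr N borel (RS_sum T n)) u =
        (\<Prod>k<Suc n. phi (real (Suc k) * (T / real (Suc n)) - real k * (T / real (Suc n)))
           (u * exp (- (real k * (T / real (Suc n))))))"
      unfolding RS_sum_def[abs_def]
      by (rule char_weighted_increments)
         (use T in \<open>auto intro!: divide_strict_right_mono mult_strict_right_mono\<close>)
    also have "\<dots> = (\<Prod>k<Suc n. exp ((T / real (Suc n)) *\<^sub>R psi (u * exp (- (real k * (T / real (Suc n)))))))"
      unfolding eq using T by (simp add: phi_eq_exp scaleR_conv_of_real)
    finally show ?thesis
      by (simp only: exp_sum finite_lessThan)
  qed
  moreover have "(\<lambda>n. \<Sum>k<Suc n. (T / real (Suc n)) *\<^sub>R psi (u * exp (- (real k * (T / real (Suc n))))))
      \<longlonglongrightarrow> RS_exponent T u"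
    unfolding RS_exponent_def
    using T by (intro riemann_sum_tendsto[where g = "\<lambda>x. psi (u * exp (- x))"] continuous_on_psi_exp) auto
  ultimately show ?thesis
    by (simp only: tendsto_exp)
qed

lemma RS_sum_tendsto:
  assumes RS: "has_RS_integral (\<lambda>s. exp (- s)) (\<lambda>s. Z s \<omega>) 0 T J" and T: "0 \<le> T"
  shows "(\<lambda>n. RS_sum T n \<omega>) \<longlonglongrightarrow> J"
proof (rule LIMSEQ_I)
  fix e :: real assume "0 < e"
  from RS[unfolded has_RS_integral_def, THEN spec, THEN mp, OF this]
  obtain d where d: "d > 0" and sums:
    "\<forall>n (t :: nat \<Rightarrow> real) \<xi>.
        t 0 = 0 \<and> t n = T \<and> (\<forall>k<n. t k \<le> \<xi> k \<and> \<xi> k \<le> t (Suc k) \<and> t (Suc k) - t k < d) \<longrightarrow>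
        \<bar>(\<Sum>k<n. exp (- \<xi> k) * (Z (t (Suc k)) \<omega> - Z (t k) \<omega>)) - J\<bar> < e"
    by (elim exE conjE)
  have "(\<lambda>n. T / real (Suc n)) \<longlonglongrightarrow> 0"
    by real_asymp
  from order_tendstoD(2)[OF this d]
  obtain n0 where n0: "\<And>n. n \<ge> n0 \<Longrightarrow> T / real (Suc n) < d"
    by (auto simp: eventually_sequentially)
  show "\<exists>n0. \<forall>n\<ge>n0. norm (RS_sum T n \<omega> - J) < e"
  proof (intro exI[of _ n0] allI impI)
    fix n assume n: "n \<ge> n0"
    define h where "h = T / real (Suc n)"
    have h: "0 \<le> h" "h < d" "real (Suc n) * h = T"
      using n0[OF n] T by (auto simp: h_def)
    have "\<bar>(\<Sum>k<Suc n. exp (- (real k * h)) * (Z (real (Suc k) * h) \<omega> - Z (real k * h) \<omega>)) - J\<bar> < e"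
      by (rule sums[rule_format, of "\<lambda>k. real k * h" "Suc n" "\<lambda>k. real k * h"])
         (use h in \<open>auto simp: algebra_simps\<close>)
    then show "norm (RS_sum T n \<omega> - J) < e"
      by (simp add: RS_sum_def h_def)
  qed
qed

section \<open>The random integral over the half-line and its functional equation\<close>

context
  fixes I :: "'b \<Rightarrow> real"
  assumes I_meas [measurable]: "I \<in> borel_measurable N"
    and I: "AE \<omega> in N. has_RS_integral_0_infinity (\<lambda>s. exp (- s)) (\<lambda>s. Z s \<omega>) (I \<omega>)"
begin

lemma exp_RS_exponent_tendsto:
  assumes T: "\<And>m. 0 < T m" "filterlim T at_top sequentially"
  shows "(\<lambda>m. exp (RS_exponent (T m) u)) \<longlonglongrightarrow> char (distr N borel I) u"
proof -
  \<comment> \<open>The pathwise integrals are chosen separately for each \<open>\<omega>\<close>.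
    Writing them as limits of measurable sums makes \<open>J m\<close> measurable.\<close>
  define J where "J m \<omega> = lim (\<lambda>n. RS_sum (T m) n \<omega>)" for m \<omega>
  have T0: "0 \<le> T m" for m using T(1)[of m] by simp
  have J_meas [measurable]: "J m \<in> borel_measurable N" for m
    unfolding J_def[abs_def] using T0 by measurable
  have RS: "AE \<omega> in N. (\<forall>m. (\<lambda>n. RS_sum (T m) n \<omega>) \<longlonglongrightarrow> J m \<omega>) \<and> (\<lambda>m. J m \<omega>) \<longlonglongrightarrow> I \<omega>"
    using I
  proof eventually_elim
    case (elim \<omega>)
    then obtain J' where J': "\<And>t. 0 \<le> t \<Longrightarrow> has_RS_integral (\<lambda>s. exp (- s)) (\<lambda>s. Z s \<omega>) 0 t (J' t)"
      "(J' \<longlongrightarrow> I \<omega>) at_top"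
      unfolding has_RS_integral_0_infinity_def by blast
    have lim: "(\<lambda>n. RS_sum (T m) n \<omega>) \<longlonglongrightarrow> J' (T m)" for m
      by (rule RS_sum_tendsto[OF J'(1)]) (rule T0)+
    then have "J m \<omega> = J' (T m)" for m
      unfolding J_def by (rule limI)
    with lim filterlim_compose[OF J'(2) T(2)] show ?case by simp
  qed
  have "char (distr N borel (J m)) u = exp (RS_exponent (T m) u)" for m
  proof (rule LIMSEQ_unique[OF _ char_RS_sum_tendsto[OF T(1)]])
    have "(\<lambda>n. CLINT \<omega>|N. iexp (u * RS_sum (T m) n \<omega>)) \<longlonglongrightarrow> (CLINT \<omega>|N. iexp (u * J m \<omega>))"
    proof (rule integral_dominated_convergence[where w = "\<lambda>_. 1"])
      show "AE \<omega> in N. (\<lambda>n. iexp (u * RS_sum (T m) n \<omega>)) \<longlonglongrightarrow> iexp (u * J m \<omega>)"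
        using RS by eventually_elim (auto intro!: tendsto_intros)
    qed (use T0 in auto)
    then show "(\<lambda>n. char (distr N borel (RS_sum (T m) n)) u) \<longlonglongrightarrow> char (distr N borel (J m)) u"
      using T0 by (simp add: char_def integral_distr)
  qed
  moreover have "(\<lambda>m. CLINT \<omega>|N. iexp (u * J m \<omega>)) \<longlonglongrightarrow> (CLINT \<omega>|N. iexp (u * I \<omega>))"
  proof (rule integral_dominated_convergence[where w = "\<lambda>_. 1"])
    show "AE \<omega> in N. (\<lambda>m. iexp (u * J m \<omega>)) \<longlonglongrightarrow> iexp (u * I \<omega>)"
      using RS by eventually_elim (auto intro!: tendsto_intros)
  qed auto
  ultimately show ?thesis
    by (simp add: char_def integral_distr)
qed

text \<open>Both sides are limits of one sequence: horizons \<open>T + real (Suc m)\<close> at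
  \<open>u\<close> on the left, horizons \<open>real (Suc m)\<close> at \<open>u * exp (- T)\<close>
  on the right.\<close>

lemma char_RS_integral_eq:
  assumes "0 \<le> T"
  shows "char (distr N borel I) u = exp (RS_exponent T u) * char (distr N borel I) (u * exp (- T))"
proof (rule LIMSEQ_unique)
  show "(\<lambda>m. exp (RS_exponent (T + real (Suc m)) u)) \<longlonglongrightarrow> char (distr N borel I) u"
    by (rule exp_RS_exponent_tendsto) (use assms in auto, real_asymp)
  have "(\<lambda>m. exp (RS_exponent (real (Suc m)) (u * exp (- T)))) \<longlonglongrightarrow> char (distr N borel I) (u * exp (- T))"
    by (rule exp_RS_exponent_tendsto) (auto, real_asymp)
  then have "(\<lambda>m. exp (RS_exponent T u) * exp (RS_exponent (real (Suc m)) (u * exp (- T))))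
      \<longlonglongrightarrow> exp (RS_exponent T u) * char (distr N borel I) (u * exp (- T))"
    by (intro tendsto_intros)
  then show "(\<lambda>m. exp (RS_exponent (T + real (Suc m)) u))
      \<longlonglongrightarrow> exp (RS_exponent T u) * char (distr N borel I) (u * exp (- T))"
    using assms by (simp only: RS_exponent_add of_nat_0_le_iff exp_add)
qed

text \<open>Scaling by \<open>exp (- real n)\<close> moves the argument towards \<open>0\<close>,
  where the characteristic function is \<open>1\<close>. The functional equation carries
  nonvanishing back to \<open>u\<close>.\<close>

lemma char_RS_integral_nonzero: "char (distr N borel I) u \<noteq> 0"
proof -
  interpret I: real_distribution "distr N borel I"
    by (rule real_distribution_distr) simp
  have "(\<lambda>n. u * exp (- real n)) \<longlonglongrightarrow> 0"
    by real_asymp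
  from isCont_tendsto_compose[OF I.isCont_char this]
  have "(\<lambda>n. char (distr N borel I) (u * exp (- real n))) \<longlonglongrightarrow> 1"
    by (simp add: I.char_zero)
  then have "\<forall>\<^sub>F n in sequentially. char (distr N borel I) (u * exp (- real n)) \<noteq> 0"
    by (rule tendsto_imp_eventually_ne) simp
  then obtain n where "char (distr N borel I) (u * exp (- real n)) \<noteq> 0"
    by (auto simp: eventually_sequentially)
  then show ?thesis
    using char_RS_integral_eq[of "real n" u] by simp
qed

lemma psi_mult_char_RS_integral:
  assumes deriv: "(char (distr N borel I) has_vector_derivative g') (at u)"
  shows "psi u * char (distr N borel I) u = of_real u * g'"
proof -
  let ?g = "char (distr N borel I)"
  let ?F = "\<lambda>T. exp (RS_exponent T u) * ?g (u * exp (- T))"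
  \<comment> \<open>All derivatives are one-sided, since the functional equation is known for
    \<open>T \<ge> 0\<close> only. By it \<open>?F\<close> is constant there, so the product rule
    must yield zero.\<close>
  have "((\<lambda>T. RS_exponent T u) has_vector_derivative psi (u * exp (- 0))) (at 0 within {0..1})"
    unfolding RS_exponent_def
    by (rule integral_has_vector_derivative[OF continuous_on_psi_exp]) simp
  moreover have "(exp has_field_derivative 1) (at (RS_exponent 0 u))"
    using DERIV_exp[of "RS_exponent 0 u"] by (simp add: RS_exponent_def)
  ultimately have 1: "((\<lambda>T. exp (RS_exponent T u)) has_vector_derivative psi u) (at 0 within {0..1})"
    using field_vector_diff_chain_within[of "\<lambda>T. RS_exponent T u" "psi u" 0 "{0..1}" exp 1]
    by (simp add: o_def has_field_derivative_at_within)
  have "((\<lambda>T. u * exp (- T)) has_vector_derivative - u) (at 0 within {0..1})"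
    by (auto intro!: derivative_eq_intros simp flip: has_real_derivative_iff_has_vector_derivative)
  moreover have "(?g has_vector_derivative g') (at (u * exp (- 0)) within (\<lambda>T. u * exp (- T)) ` {0..1})"
    using has_vector_derivative_at_within[OF deriv] by simp
  ultimately have 2: "((\<lambda>T. ?g (u * exp (- T))) has_vector_derivative - u *\<^sub>R g') (at 0 within {0..1})"
    using vector_diff_chain_within by (fastforce simp: o_def)
  have 3: "(?F has_vector_derivative psi u * ?g u - of_real u * g') (at 0 within {0..1})"
    using has_vector_derivative_mult[OF 1 2] by (simp add: RS_exponent_def scaleR_conv_of_real)
  have 4: "(?F has_vector_derivative 0) (at 0 within {0..1})"
    by (rule has_vector_derivative_transform[where f = "\<lambda>_. ?g u"])
       (auto simp: char_RS_integral_eq[symmetric] intro!: derivative_eq_intros)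
  have "psi u * ?g u - of_real u * g' = 0"
    by (rule vector_derivative_unique_within_closed_interval[of 0 1 0 ?F]) (use 3 4 in simp_all)
  then show ?thesis by simp
qed

end

end

section \<open>Taylor series of the exponent, and its values where the cumulant series
  converges\<close>

theorem proposition4p3:
  fixes M :: "'a measure" and X :: "'a \<Rightarrow> real"
    and N :: "'b measure" and Z :: "real \<Rightarrow> 'b \<Rightarrow> real" and s :: real
  assumes "prob_space M"
    and "X \<in> borel_measurable M"
    and "self_decomposable M X"
    and "all_moments M X"
    and "background_driving_levy_process M X N Z"
    and "s \<ge> 0"
  defines "C \<equiv> char_exponent (distr N borel (Z s))"
    and "K \<equiv> fps_at_iu (hurwitz_cumulant (hurwitz_moments M X))"
  shows "has_taylor_fps C (fps_const (complex_of_real s) * K)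
       \<and> (\<forall>u::real. ereal \<bar>u\<bar> < fps_conv_radius K \<longrightarrow>
            C u = complex_of_real s * eval_fps K (complex_of_real u))"
proof -
  interpret M: prob_space M by fact
  note [measurable] = \<open>X \<in> borel_measurable M\<close>
  from assms(5) obtain I where levy: "levy_process N Z" and I: "I \<in> borel_measurable N"
    "AE \<omega> in N. has_RS_integral_0_infinity (\<lambda>s. exp (- s)) (\<lambda>s. Z s \<omega>) (I \<omega>)"
    and distr: "distr M borel X = distr N borel I"
    unfolding background_driving_levy_process_def by blast
  interpret N: levy N Z
    by (intro levy.intro levy_axioms.intro levy) (use levy in \<open>simp add: levy_process_def\<close>)
  interpret D: real_distribution "distr M borel X"
    by (rule M.real_distribution_distr) simp
  define \<phi> where "\<phi> = char (distr M borel X)"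
  define F where "F = fps_at_iu (Abs_fps (\<lambda>n. hurwitz_moments M X n / fact n))"
  have mom: "integrable (distr M borel X) (\<lambda>x. x ^ n)" for n
    using assms(4) by (simp add: all_moments_def integrable_distr_eq)
  have F_alt: "fps_at_iu (Abs_fps (\<lambda>n. D.expectation (\<lambda>x. x ^ n) / fact n)) = F"
    by (simp add: F_def hurwitz_moments_def integral_distr)
  have taylor: "taylor_upto k \<phi> F" for k
    using has_taylor_fps_imp_taylor_upto[OF D.char_has_taylor_fps[OF mom]] by (simp add: F_alt \<phi>_def)
  have F0: "fps_nth F 0 = 1"
    by (simp add: F_def fps_at_iu_def hurwitz_moments_def M.prob_space)
  have nz: "\<phi> u \<noteq> 0" for u
    unfolding \<phi>_def distr by (rule N.char_RS_integral_nonzero[OF I])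
  have KF: "K * F = fps_X * fps_deriv F"
    using hurwitz_cumulant_mult[of "hurwitz_moments M X"]
    unfolding K_def F_def fps_at_iu_mult[symmetric] fps_at_iu_X_deriv[symmetric]
    by (simp add: hurwitz_moments_def M.prob_space)
  have K_eq: "K = fps_X * fps_deriv F * inverse F"
  proof -
    have "K = K * F * inverse F"
      using F0 by (simp add: mult.assoc inverse_mult_eq_1')
    then show ?thesis by (simp add: KF)
  qed
  \<comment> \<open>A fixed choice of derivative, so that one function carries the Taylor data of
    every order.\<close>
  define \<phi>' where "\<phi>' u = vector_derivative \<phi> (at u)" for u
  have deriv: "(\<phi> has_vector_derivative \<phi>' u) (at u)" and taylor': "taylor_upto k \<phi>' (fps_deriv F)" for u k
  proof -
    obtain f' where f': "\<And>x. (\<phi> has_vector_derivative f' x) (at x)" "taylor_upto k f' (fps_deriv F)"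
      using taylor[of "Suc k"] by auto
    from f'(1) have "\<phi>' = f'"
      unfolding \<phi>'_def using vector_derivative_at by blast
    with f' show "(\<phi> has_vector_derivative \<phi>' u) (at u)" "taylor_upto k \<phi>' (fps_deriv F)"
      by auto
  qed
  have psi: "N.psi u * \<phi> u = of_real u * \<phi>' u" for u
    using N.psi_mult_char_RS_integral[OF I] deriv unfolding \<phi>_def distr by blast
  then have C_eq: "C = (\<lambda>u. of_real s * (of_real u * \<phi>' u * inverse (\<phi> u)))"
    unfolding C_def N.char_exponent_Z[OF \<open>s \<ge> 0\<close>] using nz by (simp add: fun_eq_iff field_simps)
  \<comment> \<open>\<open>C_eq\<close> and \<open>K_eq\<close> are the same expression, once in
    functions and once in series, so the closure rules match them factor by factor.\<close>
  have "has_taylor_fps C (fps_const (complex_of_real s) * K)"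
    unfolding C_eq K_eq
    by (intro taylor_upto_imp_has_taylor_fps taylor_upto_mult taylor_upto_const
          taylor_upto_of_real taylor_upto_inverse taylor taylor' nz)
  moreover have "C u = complex_of_real s * eval_fps K (complex_of_real u)"
    if u: "ereal \<bar>u\<bar> < fps_conv_radius K" for u
  proof -
    have rad: "fps_conv_radius K \<le> fps_conv_radius F"
      by (rule fps_conv_radius_log_deriv_le[OF KF F0])
    have eval: "\<phi> v = eval_fps F (complex_of_real v)" if "ereal \<bar>v\<bar> < fps_conv_radius K" for v
      using D.char_eq_eval_fps[OF mom, of v] that rad unfolding F_alt \<phi>_def by simp
    have uF: "ereal \<bar>u\<bar> < fps_conv_radius F"
      using u rad by simp
    have "(eval_fps F has_field_derivative eval_fps (fps_deriv F) (of_real u)) (at (of_real u))"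
      using uF by (intro has_field_derivative_eval_fps) simp
    then have "((\<lambda>v. eval_fps F (complex_of_real v)) has_vector_derivative eval_fps (fps_deriv F) (of_real u)) (at u)"
      by (rule has_vector_derivative_real_field)
    \<comment> \<open>Comparing derivatives requires \<open>\<phi>\<close> and the sum of
      \<open>F\<close> to agree on a neighbourhood of \<open>u\<close>, hence the openness of the
      region of convergence.\<close>
    moreover have "\<forall>\<^sub>F v in nhds u. ereal \<bar>v\<bar> < fps_conv_radius K"
    proof -
      have "open {v. ereal \<bar>v\<bar> < fps_conv_radius K}"
        by (intro open_Collect_less continuous_intros)
      with u show ?thesis by (auto simp: eventually_nhds)
    qed
    then have "\<forall>\<^sub>F v in nhds u. eval_fps F (complex_of_real v) = \<phi> v"
      by eventually_elim (simp add: eval)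
    ultimately have "(\<phi> has_vector_derivative eval_fps (fps_deriv F) (of_real u)) (at u)"
      using has_vector_derivative_cong_ev[where f = "\<lambda>v. eval_fps F (complex_of_real v)" and g = \<phi>
          and S = UNIV and x = u] eval[OF u] by simp
    then have \<phi>'_eval: "\<phi>' u = eval_fps (fps_deriv F) (of_real u)"
      using deriv vector_derivative_unique_at by blast
    \<comment> \<open>Evaluated at \<open>u\<close>, the series identity becomes the equation that
      \<open>psi\<close> satisfies; division by \<open>\<phi> u\<close> then identifies the
      two.\<close>
    have "eval_fps K (of_real u) * eval_fps F (of_real u) = eval_fps (K * F) (complex_of_real u)"
      using u uF by (intro eval_fps_mult[symmetric]) auto
    also have "\<dots> = of_real u * \<phi>' u"
      unfolding KF \<phi>'_eval using uF fps_conv_radius_deriv[of F]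
      by (subst eval_fps_mult) auto
    finally show ?thesis
      using nz[of u] eval[OF u] by (simp add: C_eq field_simps)
  qed
  ultimately show ?thesis by blast
qed

end
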